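(* For $n\ge 1$ and $0\le p\le n-1$, let $K_{n,p}$ be the number of configurations of size $n$ in which exactly $p$ of the other $n-1$ pairs cross the given pair. Then $$K(y,z):=\sum_{n\geq 1}\sum_{p=0}^{n-1} K_{n,p}\, y^p \,\frac{z^n}{n!}=\frac{z}{\sqrt{1-2z}\,\bigl(1-z(1+y)\bigr)}$$ as formal power series.
   Context: Fix $n\ge1$. A configuration (of size $n$) is a perfect matching of the $2n$ points $1,2,\dots,2n$ (laid out on a line) into $n$ unordered pairs, together with one distinguished pair, called the given pair; the other $n-1$ pairs are treated as indistinguishable, so there are $n\,(2n-1)!!$ configurations. Let the given pair be $\{g<h\}$ and let $\{a<b\}$ be another pair. The pair $\{a,b\}$ crosses the given pair if exactly one of $a,b$ lies strictly between $g$ and $h$. *)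

theory Defs
  imports
    Complex_Main
    "HOL-Library.Disjoint_Sets"
    "HOL-Computational_Algebra.Formal_Power_Series"
begin

unbundle fps_syntax

definition perfect_matching :: "'a set \<Rightarrow> 'a set set \<Rightarrow> bool" where
  "perfect_matching A M \<longleftrightarrow> partition_on A M \<and> (\<forall>e\<in>M. card e = 2)"

definition configurations :: "nat \<Rightarrow> (nat set set \<times> nat set) set" where
  "configurations n = {(M, g). perfect_matching {1..2 * n} M \<and> g \<in> M}"

definition crosses :: "nat set \<Rightarrow> nat set \<Rightarrow> bool" where
  "crosses e g \<longleftrightarrow> (\<exists>!x. x \<in> e \<and> Min g < x \<and> x < Max g)"

definition K_count :: "nat \<Rightarrow> nat \<Rightarrow> nat" where
  "K_count n p = card {(M, g). (M, g) \<in> configurations n \<and> card {e \<in> M - {g}. crosses e g} = p}"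

text \<open>
  Bivariate series are series in \<open>z\<close> (outer variable) whose coefficients are series
  in \<open>y\<close> (inner variable).
\<close>

abbreviation var_z :: "real fps fps" where
  "var_z \<equiv> fps_X"

abbreviation var_y :: "real fps fps" where
  "var_y \<equiv> fps_const fps_X"

definition lift_z :: "real fps \<Rightarrow> real fps fps" where
  "lift_z f = Abs_fps (\<lambda>n. fps_const (f $ n))"

text \<open>
  The square root with constant term 1. It is taken over the field of reals, since
  \<^const>\<open>fps_radical\<close> needs field coefficients.
\<close>

definition sqrt_1_minus_2z :: "real fps fps" where
  "sqrt_1_minus_2z = lift_z (fps_radical root 2 (1 - 2 * fps_X))"

definition K_series :: "real fps fps" where
  "K_series = Abs_fps (\<lambda>n. if n \<ge> 1
     then \<Sum>p=0..n-1. fps_const (real (K_count n p) / fact n) * fps_X ^ p else 0)"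

lemma lift_z_mult: "lift_z (f * g) = lift_z f * lift_z g"
  by (rule fps_ext, rule fps_ext)
     (simp add: lift_z_def fps_mult_nth fps_sum_nth if_distrib cong: if_cong)

lemma sqrt_1_minus_2z_nth_0: "sqrt_1_minus_2z $ 0 = 1"
  by (simp add: sqrt_1_minus_2z_def lift_z_def)

lemma sqrt_1_minus_2z_power2: "sqrt_1_minus_2z ^ 2 = 1 - 2 * var_z"
proof -
  have "fps_radical root 2 (1 - 2 * fps_X :: real fps) ^ 2 = 1 - 2 * fps_X"
    using power_radical[of "1 - 2 * fps_X :: real fps" root 1] by (simp add: numeral_2_eq_2)
  moreover have "lift_z (1 - 2 * fps_X) = 1 - 2 * var_z"
    by (rule fps_ext) (auto simp: lift_z_def numeral_fps_const)
  ultimately show ?thesis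
    by (simp add: sqrt_1_minus_2z_def power2_eq_square flip: lift_z_mult)
qed

text \<open>
  The coefficient ring is not a field, so it has to be checked that dividing by a
  series with constant term 1 is division in the ring.
\<close>

lemma divide_mult_cancel_unit:
  fixes f g :: "real fps fps"
  assumes "g $ 0 = 1"
  shows "f / g * g = f"
proof -
  have "subdegree g = 0"
    using assms by (intro subdegree_eq_0) auto
  moreover have "inverse g * g = 1"
    using fps_right_inverse[of g 1] assms by (simp add: fps_inverse_def fps_lr_inverse_one_one mult.commute)
  ultimately show ?thesis
    by (simp add: fps_divide_def mult.assoc)
qed

end

theory Submission
  imports Defs
begin

text \<open>
  Removing the given pair leaves a matching of \<open>2n\<close> points, of which some number \<open>m\<close> lie between
  the endpoints of the given pair; there are \<open>2n + 1 - m\<close> given pairs with that \<open>m\<close>. Let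
  \<open>T(m, k, p)\<close> be the number of matchings of \<open>m\<close> inner and \<open>k\<close> outer points with \<open>p\<close> mixed pairs.
  It is symmetric in \<open>m\<close> and \<open>k\<close>, so the weight \<open>2n + 1 - m\<close> averages to \<open>n + 1\<close>, and
  \<open>K\<close> at \<open>(n + 1, p)\<close> equals \<open>(n + 1) S(n, p)\<close>, where \<open>S(n, p)\<close> is the sum of \<open>T(m, 2n - m, p)\<close>
  over \<open>m\<close>. Removing an inner point with its partner and averaging once more gives
  \<open>S(n + 1, p) = T(0, 2n + 2, p) + (n + 1) (S(n, p) + S(n, p - 1))\<close>. In terms of the series
  \<open>L\<close> with coefficients \<open>S(n, p) / n!\<close> this says \<open>L (1 - z (1 + y)) = D\<close>, where
  \<open>D\<close> has coefficients \<open>(2n - 1)!! / n!\<close> and is the inverse of the square root because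
  \<open>(1 - 2z) D' = D\<close>.
\<close>

section \<open>Adding a pair to a perfect matching\<close>

text \<open>If \<open>e\<close> meets a member of \<open>M\<close>, both sides fail: on the left
  \<open>e\<close> would overlap a different pair, on the right \<open>M\<close> would leave
  \<open>A - e\<close>. Otherwise this is \<open>partition_on_insert\<close>.\<close>

lemma perfect_matching_insert:
  assumes "card e = 2" "e \<notin> M"
  shows "perfect_matching A (insert e M) \<longleftrightarrow> e \<subseteq> A \<and> perfect_matching (A - e) M"
proof -
  have "e \<noteq> {}"
    using assms(1) by auto
  have eq: ?thesis if "disjnt e (\<Union>M)"
    unfolding perfect_matching_def partition_on_insert[OF that]
    using assms(1) \<open>e \<noteq> {}\<close> by simp blast
  show ?thesis
  proof (cases "disjnt e (\<Union>M)")
    case False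
    then obtain d where d: "d \<in> M" "e \<inter> d \<noteq> {}"
      by (auto simp: disjnt_def)
    have "\<not> perfect_matching A (insert e M)"
    proof
      assume "perfect_matching A (insert e M)"
      then have "disjoint (insert e M)"
        by (simp add: perfect_matching_def partition_on_def)
      moreover have "e \<noteq> d"
        using d(1) assms(2) by metis
      ultimately have "e \<inter> d = {}"
        using d(1) by (intro disjointD[of "insert e M"]) simp_all
      with d(2) show False
        by contradiction
    qed
    moreover have "\<not> perfect_matching (A - e) M"
    proof
      assume "perfect_matching (A - e) M"
      then have "\<Union>M = A - e"
        by (simp add: perfect_matching_def partition_on_def)
      then show False
        using False by (simp add: disjnt_def)
    qed
    ultimately show ?thesis
      by simp
  qed (rule eq)
qed

lemma perfect_matching_empty_iff: "perfect_matching {} M \<longleftrightarrow> M = {}"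
  by (auto simp: perfect_matching_def partition_on_empty)

lemma perfect_matching_notin:
  assumes "perfect_matching (A - e) M" "card e = 2"
  shows "e \<notin> M"
proof
  assume "e \<in> M"
  then have "e \<subseteq> A - e"
    using assms(1) by (auto simp: perfect_matching_def partition_on_def)
  then have "e = {}"
    by blast
  then show False
    using assms(2) by simp
qed

section \<open>Matchings of inner and outer points, counted by mixed pairs\<close>

text \<open>\<open>I\<close> marks the inner points, and a pair is mixed when it meets
  \<open>I\<close> in exactly one point. \<open>I\<close> may exceed \<open>A\<close>, so it can
  stay fixed while points are removed from \<open>A\<close>.\<close>

definition split_matchings :: "'a set \<Rightarrow> 'a set \<Rightarrow> nat \<Rightarrow> 'a set set set" where
  "split_matchings A I p = {M. perfect_matching A M \<and> card {e \<in> M. card (e \<inter> I) = 1} = p}"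

lemma finite_perfect_matching: "finite A \<Longrightarrow> perfect_matching A M \<Longrightarrow> finite M"
  by (auto simp: perfect_matching_def intro: finite_elements)

lemma finite_split_matchings: "finite A \<Longrightarrow> finite (split_matchings A I p)"
  by (rule finite_subset[of _ "Pow (Pow A)"])
    (auto simp: split_matchings_def perfect_matching_def partition_on_def)

lemma split_matchings_restrict:
  assumes "A \<inter> I = A \<inter> J"
  shows "split_matchings A I p = split_matchings A J p"
proof -
  have "{e \<in> M. card (e \<inter> I) = 1} = {e \<in> M. card (e \<inter> J) = 1}" if "perfect_matching A M" for M
  proof -
    have "e \<inter> I = e \<inter> J" if "e \<in> M" for e
      using \<open>perfect_matching A M\<close> that assms by (auto simp: perfect_matching_def partition_on_def)
    then show ?thesis
      by auto
  qed
  then show ?thesis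
    by (auto simp: split_matchings_def)
qed

text \<open>A pair has two points, so it meets \<open>I\<close> once exactly when it meets the
  complement once. This is the source of the symmetry between inner and outer points.\<close>

lemma split_matchings_complement:
  assumes "finite A"
  shows "split_matchings A (A - I) p = split_matchings A I p"
proof -
  have "{e \<in> M. card (e \<inter> (A - I)) = 1} = {e \<in> M. card (e \<inter> I) = 1}" if "perfect_matching A M" for M
  proof -
    have "card (e \<inter> (A - I)) = 1 \<longleftrightarrow> card (e \<inter> I) = 1" if "e \<in> M" for e
    proof -
      have e: "e \<subseteq> A" "card e = 2"
        using \<open>perfect_matching A M\<close> that by (auto simp: perfect_matching_def partition_on_def)
      then have "finite e"
        by (auto intro: card_ge_0_finite)
      then have "card e = card (e \<inter> I) + card (e - I)"
        by (rule card_Int_Diff)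
      moreover have "e \<inter> (A - I) = e - I"
        using e by auto
      ultimately show ?thesis
        using e by auto
    qed
    then show ?thesis
      by auto
  qed
  then show ?thesis
    by (auto simp: split_matchings_def)
qed

lemma split_matchings_insert:
  assumes "finite A" "card e = 2" "e \<subseteq> A" "e \<notin> M"
  shows "insert e M \<in> split_matchings A I p \<longleftrightarrow>
    (if card (e \<inter> I) = 1 then p > 0 \<and> M \<in> split_matchings (A - e) I (p - 1)
     else M \<in> split_matchings (A - e) I p)"
proof (cases "perfect_matching (A - e) M")
  case True
  then have "finite M"
    using assms(1) finite_perfect_matching by blast
  moreover have "{d \<in> insert e M. card (d \<inter> I) = 1} =
      (if card (e \<inter> I) = 1 then insert e {d \<in> M. card (d \<inter> I) = 1} else {d \<in> M. card (d \<inter> I) = 1})"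
    by auto
  ultimately have "card {d \<in> insert e M. card (d \<inter> I) = 1} =
      (if card (e \<inter> I) = 1 then 1 else 0) + card {d \<in> M. card (d \<inter> I) = 1}"
    using assms(4) by simp
  then show ?thesis
    using True assms by (auto simp: split_matchings_def perfect_matching_insert)
next
  case False
  then show ?thesis
    using assms by (auto simp: split_matchings_def perfect_matching_insert)
qed

lemma perfect_matching_partner:
  assumes "perfect_matching A M" "x \<in> A"
  obtains y where "y \<in> A - {x}" "{x, y} \<in> M"
proof -
  obtain e where e: "e \<in> M" "x \<in> e"
    using assms by (auto simp: perfect_matching_def partition_on_def)
  then have "card e = 2"
    using assms(1) by (auto simp: perfect_matching_def)
  then obtain y where "e = {x, y}" "x \<noteq> y"
    using e(2) by (auto simp: card_2_iff)
  moreover have "e \<subseteq> A"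
    using assms(1) e(1) by (auto simp: perfect_matching_def partition_on_def)
  ultimately show thesis
    using that e by auto
qed

text \<open>Matchings are classified by the partner \<open>y\<close> of the fixed point
  \<open>x\<close>. Deleting the pair lowers the number of mixed pairs exactly when just one of
  \<open>x\<close> and \<open>y\<close> is inner.\<close>

lemma card_split_matchings_rec:
  assumes "finite A" "x \<in> A"
  shows "card (split_matchings A I p) =
    (\<Sum>y\<in>A - {x}. if x \<in> I \<longleftrightarrow> y \<in> I then card (split_matchings (A - {x, y}) I p)
       else if p = 0 then 0 else card (split_matchings (A - {x, y}) I (p - 1)))"
proof -
  define B where "B y = {M \<in> split_matchings A I p. {x, y} \<in> M}" for y
  have "split_matchings A I p = (\<Union>y\<in>A - {x}. B y)"
  proof (intro equalityI subsetI)
    fix M assume M: "M \<in> split_matchings A I p"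
    then have "perfect_matching A M"
      by (simp add: split_matchings_def)
    then obtain y where "y \<in> A - {x}" "{x, y} \<in> M"
      using assms(2) by (rule perfect_matching_partner)
    with M show "M \<in> (\<Union>y\<in>A - {x}. B y)"
      unfolding B_def by (intro UN_I[of y]) simp_all
  qed (simp add: B_def)
  moreover have "card (\<Union>y\<in>A - {x}. B y) = (\<Sum>y\<in>A - {x}. card (B y))"
  proof (rule card_UN_disjoint)
    show "\<forall>y\<in>A - {x}. finite (B y)"
      using assms(1) by (simp add: B_def finite_split_matchings)
    have "y = z" if "M \<in> B y" "M \<in> B z" for y z M
    proof -
      have "disjoint M" "{x, y} \<in> M" "{x, z} \<in> M"
        using that by (auto simp: B_def split_matchings_def perfect_matching_def partition_on_def)
      then have "{x, y} = {x, z}"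
        using disjointD[of M "{x, y}" "{x, z}"] by (metis Int_iff emptyE insertI1)
      then show ?thesis
        by (auto simp: doubleton_eq_iff)
    qed
    then show "\<forall>y\<in>A - {x}. \<forall>z\<in>A - {x}. y \<noteq> z \<longrightarrow> B y \<inter> B z = {}"
      by blast
  qed (use assms in auto)
  moreover have "card (B y) = (if x \<in> I \<longleftrightarrow> y \<in> I then card (split_matchings (A - {x, y}) I p)
       else if p = 0 then 0 else card (split_matchings (A - {x, y}) I (p - 1)))"
    if y: "y \<in> A - {x}" for y
  proof -
    define C where "C = (if x \<in> I \<longleftrightarrow> y \<in> I then split_matchings (A - {x, y}) I p
       else if p = 0 then {} else split_matchings (A - {x, y}) I (p - 1))"
    have e: "card {x, y} = 2" "{x, y} \<subseteq> A"
      using y assms by auto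
    have split: "card ({x, y} \<inter> I) = 1 \<longleftrightarrow> (x \<in> I \<longleftrightarrow> y \<notin> I)"
      using y by (cases "x \<in> I"; cases "y \<in> I") auto
    have C_notin: "{x, y} \<notin> M" if "M \<in> C" for M
      using that e(1) perfect_matching_notin[of A "{x, y}"]
      by (auto simp: C_def split_matchings_def split: if_splits)
    have ins: "insert {x, y} M \<in> split_matchings A I p \<longleftrightarrow> M \<in> C" if "{x, y} \<notin> M" for M
      unfolding split_matchings_insert[OF assms(1) e that] split C_def by auto
    \<comment> \<open>Putting the deleted pair back is a bijection from \<open>C\<close> to
      \<open>B y\<close>.\<close>
    have "B y = insert {x, y} ` C"
    proof
      show "B y \<subseteq> insert {x, y} ` C"
      proof
        fix M assume "M \<in> B y"
        then have M: "M = insert {x, y} (M - {{x, y}})" "M \<in> split_matchings A I p"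
          by (auto simp: B_def)
        then have "M - {{x, y}} \<in> C"
          using ins[of "M - {{x, y}}"] by simp
        with M(1) show "M \<in> insert {x, y} ` C"
          by (rule image_eqI)
      qed
      show "insert {x, y} ` C \<subseteq> B y"
        using ins C_notin by (auto simp: B_def)
    qed
    moreover have "inj_on (insert {x, y}) C"
      by (rule inj_onI) (metis C_notin insert_ident)
    ultimately have "card (B y) = card C"
      by (simp add: card_image)
    then show ?thesis
      by (simp add: C_def)
  qed
  ultimately show ?thesis
    by simp
qed

text \<open>The differences truncate only where they are multiplied by \<open>0\<close>.\<close>

fun split_number :: "nat \<Rightarrow> nat \<Rightarrow> nat \<Rightarrow> nat" where
  "split_number 0 0 p = (if p = 0 then 1 else 0)"
| "split_number 0 (Suc k) p = k * split_number 0 (k - 1) p"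
| "split_number (Suc m) k p = m * split_number (m - 1) k p +
     (if p = 0 then 0 else k * split_number m (k - 1) (p - 1))"

text \<open>Induction on the size of \<open>A\<close>. The point to be matched is an inner one if
  there is any, otherwise an arbitrary one; these choices and the empty case give the three clauses
  of \<open>split_number\<close>.\<close>

lemma card_split_matchings:
  assumes "finite A" "I \<subseteq> A"
  shows "card (split_matchings A I p) = split_number (card I) (card (A - I)) p"
  using assms
proof (induction "card A" arbitrary: A I p rule: less_induct)
  case less
  have fin: "finite I"
    using less.prems finite_subset by auto
  have IH: "card (split_matchings (A - {x, y}) I q) =
      split_number (card (I - {x, y})) (card (A - I - {x, y})) q" if "x \<in> A" for x y q
  proof -
    \<comment> \<open>The induction hypothesis asks for a subset of the smaller ground set, so
      \<open>I\<close> is first cut down to it.\<close>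
    have "split_matchings (A - {x, y}) I q = split_matchings (A - {x, y}) (I - {x, y}) q"
      by (rule split_matchings_restrict) auto
    moreover have "card (A - {x, y}) < card A"
      using that less.prems by (auto intro!: psubset_card_mono)
    moreover have "A - {x, y} - (I - {x, y}) = A - I - {x, y}"
      by auto
    ultimately show ?thesis
      using less.hyps[of "A - {x, y}" "I - {x, y}" q] less.prems by auto
  qed
  show ?case
  proof (cases "A = {}")
    case True
    then have "split_matchings A I p = (if p = 0 then {{}} else {})"
      by (auto simp: split_matchings_def perfect_matching_empty_iff)
    with True less.prems show ?thesis
      by auto
  next
    case False
    show ?thesis
    proof (cases "I = {}")
      case True
      obtain x where x: "x \<in> A"
        using False by auto
      then obtain k where k: "card A = Suc k"
        using less.prems by (metis card_Suc_Diff1)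
      have "card (split_matchings A I p) = (\<Sum>y\<in>A - {x}. split_number 0 (k - 1) p)"
        unfolding card_split_matchings_rec[OF less.prems(1) x]
      proof (rule sum.cong)
        fix y assume "y \<in> A - {x}"
        then have "x \<noteq> y" "y \<in> A"
          by auto
        then have "card (A - {x, y}) = k - 1"
          using x k less.prems by (simp add: card_Diff_subset)
        with True have "card (split_matchings (A - {x, y}) I p) = split_number 0 (k - 1) p"
          using IH[OF x, of y p] by simp
        then show "(if x \<in> I \<longleftrightarrow> y \<in> I then card (split_matchings (A - {x, y}) I p)
            else if p = 0 then 0 else card (split_matchings (A - {x, y}) I (p - 1))) =
            split_number 0 (k - 1) p"
          using True by simp
      qed simp
      then show ?thesis
        using True k x less.prems by simp
    next
      case False
      then obtain x where x: "x \<in> I"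
        by auto
      then have xA: "x \<in> A"
        using less.prems by auto
      obtain m where m: "card I = Suc m"
        using x fin by (metis card_Suc_Diff1)
      define k where "k = card (A - I)"
      let ?f = "\<lambda>y. if x \<in> I \<longleftrightarrow> y \<in> I then card (split_matchings (A - {x, y}) I p)
            else if p = 0 then 0 else card (split_matchings (A - {x, y}) I (p - 1))"
      have "A - {x} = (I - {x}) \<union> (A - I)"
        using x less.prems by auto
      then have "card (split_matchings A I p) = sum ?f (I - {x}) + sum ?f (A - I)"
        unfolding card_split_matchings_rec[OF less.prems(1) xA]
        using fin less.prems by (subst sum.union_disjoint[symmetric]) auto
      moreover have "sum ?f (I - {x}) = (\<Sum>y\<in>I - {x}. split_number (m - 1) k p)"
      proof (rule sum.cong)
        fix y assume y: "y \<in> I - {x}"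
        then have "x \<noteq> y" "y \<in> I"
          by auto
        then have "card (I - {x, y}) = m - 1"
          using x m fin by (simp add: card_Diff_subset)
        moreover have "A - I - {x, y} = A - I"
          using x y by auto
        ultimately show "?f y = split_number (m - 1) k p"
          using x y by (simp add: IH[OF xA] k_def)
      qed simp
      moreover have "sum ?f (A - I) =
          (\<Sum>y\<in>A - I. if p = 0 then 0 else split_number m (k - 1) (p - 1))"
      proof (rule sum.cong)
        fix y assume y: "y \<in> A - I"
        then have "I - {x, y} = I - {x}" "A - I - {x, y} = A - I - {y}"
          using x by auto
        then have "card (I - {x, y}) = m" "card (A - I - {x, y}) = k - 1"
          using x y m fin less.prems by (simp_all add: k_def)
        then show "?f y = (if p = 0 then 0 else split_number m (k - 1) (p - 1))"
          using x y by (simp add: IH[OF xA])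
      qed simp
      ultimately show ?thesis
        using m x fin by (simp add: k_def)
    qed
  qed
qed

text \<open>The recursion treats its first two arguments differently, so the symmetry is read off
  from the sets it counts, by exchanging \<open>I\<close> with its complement.\<close>

lemma split_number_commute: "split_number m k p = split_number k m p"
proof -
  define A where "A = {..<m + k}"
  define I where "I = {..<m}"
  have A: "finite A" "I \<subseteq> A" "A - (A - I) = I"
    by (auto simp: A_def I_def)
  have "card I = m" "card (A - I) = k"
    using A by (simp_all add: card_Diff_subset finite_subset) (simp_all add: A_def I_def)
  then have "split_number m k p = card (split_matchings A I p)"
    using card_split_matchings[OF A(1,2)] by simp
  also have "\<dots> = card (split_matchings A (A - I) p)"
    by (simp only: split_matchings_complement[OF A(1)])
  also have "\<dots> = split_number k m p"
    using card_split_matchings[OF A(1), of "A - I" p] A(3) \<open>card I = m\<close> \<open>card (A - I) = k\<close> by simp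
  finally show ?thesis .
qed

lemma split_number_eq_0: "p > m \<Longrightarrow> split_number m k p = 0"
  by (induction m k p rule: split_number.induct) auto

section \<open>Summation over the number of inner points\<close>

definition split_sum :: "nat \<Rightarrow> nat \<Rightarrow> nat" where
  "split_sum n p = (\<Sum>m\<le>2 * n. split_number m (2 * n - m) p)"

text \<open>Each mixed pair uses one inner and one outer point, and one of the two kinds has at most
  \<open>n\<close> points.\<close>

lemma split_sum_eq_0:
  assumes "p > n"
  shows "split_sum n p = 0"
proof -
  have "split_number m (2 * n - m) p = 0" if "m \<le> 2 * n" for m
  proof (cases "p > m")
    case False
    then have "p > 2 * n - m"
      using assms by auto
    then show ?thesis
      by (metis split_number_commute split_number_eq_0)
  qed (rule split_number_eq_0)
  then show ?thesis
    by (simp add: split_sum_def)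
qed

text \<open>Reflection exchanges the two weights, so the two sums agree; the weights add up to
  \<open>2 * n + 2\<close>, so each sum is half of that multiple.\<close>

lemma sum_weighted_reflect:
  fixes f :: "nat \<Rightarrow> nat"
  assumes "\<And>m. m \<le> 2 * n \<Longrightarrow> f (2 * n - m) = f m"
  shows "(\<Sum>m\<le>2 * n. (2 * n + 1 - m) * f m) = (n + 1) * (\<Sum>m\<le>2 * n. f m)"
    and "(\<Sum>m\<le>2 * n. (m + 1) * f m) = (n + 1) * (\<Sum>m\<le>2 * n. f m)"
proof -
  have eq: "(\<Sum>m\<le>2 * n. (2 * n + 1 - m) * f m) = (\<Sum>m\<le>2 * n. (m + 1) * f m)"
    by (rule sum.reindex_bij_witness[of _ "\<lambda>m. 2 * n - m" "\<lambda>m. 2 * n - m"])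
      (auto simp: assms Suc_diff_le)
  have "(\<Sum>m\<le>2 * n. (2 * n + 1 - m) * f m) + (\<Sum>m\<le>2 * n. (m + 1) * f m) =
      (\<Sum>m\<le>2 * n. (2 * n + 2) * f m)"
    unfolding sum.distrib[symmetric]
  proof (rule sum.cong)
    fix m assume "m \<in> {..2 * n}"
    then have "(2 * n + 1 - m) + (m + 1) = 2 * n + 2"
      by auto
    then show "(2 * n + 1 - m) * f m + (m + 1) * f m = (2 * n + 2) * f m"
      by (metis add_mult_distrib)
  qed simp
  then have "2 * (\<Sum>m\<le>2 * n. (m + 1) * f m) = (2 * n + 2) * (\<Sum>m\<le>2 * n. f m)"
    unfolding eq mult_2[of "\<Sum>m\<le>2 * n. (m + 1) * f m"] by (rule trans) (rule sum_distrib_left[symmetric])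
  then have "2 * (\<Sum>m\<le>2 * n. (m + 1) * f m) = 2 * ((n + 1) * (\<Sum>m\<le>2 * n. f m))"
    by (simp only: add_mult_distrib mult.assoc) simp
  then show "(\<Sum>m\<le>2 * n. (m + 1) * f m) = (n + 1) * (\<Sum>m\<le>2 * n. f m)"
    by (simp only: mult_cancel1) simp
  with eq show "(\<Sum>m\<le>2 * n. (2 * n + 1 - m) * f m) = (n + 1) * (\<Sum>m\<le>2 * n. f m)"
    by simp
qed

lemma split_number_reflect:
  "m \<le> 2 * n \<Longrightarrow> split_number (2 * n - m) (2 * n - (2 * n - m)) p = split_number m (2 * n - m) p"
  by (simp add: split_number_commute)

lemma split_sum_Suc:
  "split_sum (Suc n) p = split_number 0 (2 * Suc n) p +
     (n + 1) * (split_sum n p + (if p = 0 then 0 else split_sum n (p - 1)))"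
proof -
  define N where "N = 2 * n"
  have "split_sum (Suc n) p = (\<Sum>m\<le>Suc (Suc N). split_number m (Suc (Suc N) - m) p)"
    by (simp add: split_sum_def N_def)
  also have "\<dots> = split_number 0 (Suc (Suc N)) p + (\<Sum>m\<le>Suc N. split_number (Suc m) (Suc N - m) p)"
    by (subst sum.atMost_Suc_shift) simp
  also have "(\<Sum>m\<le>Suc N. split_number (Suc m) (Suc N - m) p) =
      (\<Sum>m\<le>Suc N. m * split_number (m - 1) (Suc N - m) p) +
      (\<Sum>m\<le>Suc N. if p = 0 then 0 else (Suc N - m) * split_number m (Suc N - m - 1) (p - 1))"
    by (simp add: sum.distrib)
  \<comment> \<open>The term at \<open>m = 0\<close> vanishes, and shifting the index gives the
    weight \<open>m + 1\<close>.\<close>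
  also have "(\<Sum>m\<le>Suc N. m * split_number (m - 1) (Suc N - m) p) =
      (\<Sum>m\<le>N. (m + 1) * split_number m (N - m) p)"
    by (subst sum.atMost_Suc_shift) simp
  also have "\<dots> = (n + 1) * split_sum n p"
    unfolding N_def split_sum_def by (rule sum_weighted_reflect(2)) (rule split_number_reflect)
  \<comment> \<open>The top term \<open>m = Suc N\<close> has weight 0 and drops out.\<close>
  also have "(\<Sum>m\<le>Suc N. if p = 0 then 0 else (Suc N - m) * split_number m (Suc N - m - 1) (p - 1)) =
      (if p = 0 then 0 else \<Sum>m\<le>N. (N + 1 - m) * split_number m (N - m) (p - 1))"
    by (auto intro!: sum.cong)
  also have "(\<Sum>m\<le>N. (N + 1 - m) * split_number m (N - m) (p - 1)) = (n + 1) * split_sum n (p - 1)"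
    unfolding N_def split_sum_def by (rule sum_weighted_reflect(1)) (rule split_number_reflect)
  finally show ?thesis
    by (simp add: N_def algebra_simps)
qed

section \<open>From configurations to split matchings\<close>

lemma crosses_doubleton:
  assumes "a < b"
  shows "crosses e {a, b} \<longleftrightarrow> card (e \<inter> {a<..<b}) = 1"
proof -
  have "Min {a, b} = a" "Max {a, b} = b"
    using assms by auto
  then have "crosses e {a, b} \<longleftrightarrow> (\<exists>!x. x \<in> e \<inter> {a<..<b})"
    by (simp add: crosses_def)
  also have "\<dots> \<longleftrightarrow> is_singleton (e \<inter> {a<..<b})"
    by (metis is_singletonE is_singletonI' singletonD insertI1 empty_iff)
  finally show ?thesis
    by (simp only: is_singleton_altdef)
qed

text \<open>A configuration amounts to its given pair, stored as \<open>(a, b)\<close> with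
  \<open>a < b\<close>, and a matching of the other points. With the points between \<open>a\<close>
  and \<open>b\<close> as inner points, crossing pairs are the mixed ones.\<close>

lemma K_count_Suc: "K_count (Suc n) p = (n + 1) * split_sum n p"
proof -
  define A where "A = {1..2 * Suc n}"
  define P where "P = {(a, b). a \<in> A \<and> b \<in> A \<and> a < b}"
  define C where "C = (\<lambda>(a, b). split_matchings (A - {a, b}) {a<..<b} p)"
  define F where "F = (\<lambda>((a, b), M). (insert {a, b} M, {a, b :: nat}))"
  have finP: "finite P"
    by (rule finite_subset[of _ "A \<times> A"]) (auto simp: P_def A_def)
  have notin: "{a, b} \<notin> M" if "(a, b) \<in> P" "M \<in> C (a, b)" for a b M
    using that perfect_matching_notin[of A "{a, b}" M]
    by (auto simp: P_def C_def split_matchings_def)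
  have "{(M, g). (M, g) \<in> configurations (Suc n) \<and> card {e \<in> M - {g}. crosses e g} = p} = F ` Sigma P C"
    (is "?L = _")
  proof (intro equalityI subsetI)
    fix c assume "c \<in> ?L"
    then obtain M g where c: "c = (M, g)" and M: "perfect_matching A M" and g: "g \<in> M"
      and p: "card {e \<in> M - {g}. crosses e g} = p"
      by (auto simp: configurations_def A_def)
    have "card g = 2" "g \<subseteq> A"
      using M g by (auto simp: perfect_matching_def partition_on_def)
    then obtain a b where ab: "g = {a, b}" "a < b" "(a, b) \<in> P"
      unfolding card_2_iff P_def by (metis (lifting) case_prodI insert_commute insert_subset linorder_neqE_nat mem_Collect_eq)
    have "M = insert g (M - {g})"
      using g by auto
    with M have "perfect_matching (A - g) (M - {g})"
      using perfect_matching_insert[OF \<open>card g = 2\<close>, of "M - {g}" A] by auto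
    then have "M - {g} \<in> C (a, b)"
      using p ab by (simp add: C_def split_matchings_def crosses_doubleton)
    moreover have "c = F ((a, b), M - {g})"
      using c ab g by (auto simp: F_def)
    ultimately show "c \<in> F ` Sigma P C"
      using ab by blast
  next
    fix c assume "c \<in> F ` Sigma P C"
    then obtain a b M where ab: "(a, b) \<in> P" and M: "M \<in> C (a, b)"
      and c: "c = (insert {a, b} M, {a, b})"
      by (auto simp: F_def)
    have e: "{a, b} \<subseteq> A" "card {a, b} = 2" "a < b"
      using ab by (auto simp: P_def)
    have nM: "{a, b} \<notin> M"
      using ab M by (rule notin)
    then have "perfect_matching A (insert {a, b} M)"
      using M e by (simp add: perfect_matching_insert C_def split_matchings_def)
    moreover have "card {e \<in> insert {a, b} M - {{a, b}}. crosses e {a, b}} = p"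
      using M nM by (simp add: crosses_doubleton[OF e(3)] C_def split_matchings_def)
    ultimately show "c \<in> ?L"
      by (simp add: c configurations_def A_def insertI1 del: insert_iff Diff_iff)
  qed
  \<comment> \<open>The order \<open>a < b\<close> recovers \<open>(a, b)\<close> from the given
    pair, and \<open>notin\<close> recovers \<open>M\<close> by deleting that pair.\<close>
  moreover have "inj_on F (Sigma P C)"
  proof (rule inj_onI)
    fix s t assume s: "s \<in> Sigma P C" and t: "t \<in> Sigma P C" and eq: "F s = F t"
    obtain a b M where s': "s = ((a, b), M)"
      by (metis surj_pair)
    obtain a' b' M' where t': "t = ((a', b'), M')"
      by (metis surj_pair)
    have "a = a'" "b = b'"
      using s t eq by (auto simp: s' t' F_def P_def doubleton_eq_iff)
    moreover have "M = M'"
      using s t eq notin[of a b M] notin[of a b M'] \<open>a = a'\<close> \<open>b = b'\<close>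
      by (auto simp: s' t' F_def dest: insert_ident)
    ultimately show "s = t"
      by (simp add: s' t')
  qed
  ultimately have "K_count (Suc n) p = card (Sigma P C)"
    by (simp add: K_count_def card_image)
  also have "\<dots> = (\<Sum>q\<in>P. card (C q))"
    using finP by (intro card_SigmaI) (auto simp: C_def A_def intro!: finite_split_matchings)
  also have "\<dots> = (\<Sum>(a, b)\<in>P. split_number (b - a - 1) (2 * n - (b - a - 1)) p)"
  proof (rule sum.cong)
    fix q assume "q \<in> P"
    then obtain a b where q: "q = (a, b)" "a \<in> A" "b \<in> A" "a < b"
      by (auto simp: P_def)
    then have sub: "{a<..<b} \<subseteq> A - {a, b}"
      by (auto simp: A_def)
    have "card (A - {a, b}) = 2 * n"
      using q by (simp add: card_Diff_subset A_def)
    then have "card (A - {a, b} - {a<..<b}) = 2 * n - (b - a - 1)"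
      using sub by (subst card_Diff_subset) auto
    then show "card (C q) = (case q of (a, b) \<Rightarrow> split_number (b - a - 1) (2 * n - (b - a - 1)) p)"
      using sub q by (simp add: C_def card_split_matchings A_def)
  qed simp
  \<comment> \<open>The new index \<open>m = b - a - 1\<close> counts the inner points;
    \<open>b = a + m + 1\<close> stays within \<open>2 * n + 2\<close> exactly for \<open>a\<close>
    up to \<open>2 * n + 1 - m\<close>.\<close>
  also have "\<dots> = (\<Sum>(m, a)\<in>(SIGMA m:{..2 * n}. {1..2 * n + 1 - m}). split_number m (2 * n - m) p)"
    by (rule sum.reindex_bij_witness[of _ "\<lambda>(m, a). (a, a + m + 1)" "\<lambda>(a, b). (b - a - 1, a)"])
      (auto simp: P_def A_def)
  also have "\<dots> = (\<Sum>m\<le>2 * n. (2 * n + 1 - m) * split_number m (2 * n - m) p)"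
    by (subst sum.Sigma[symmetric]) auto
  also have "\<dots> = (n + 1) * split_sum n p"
    unfolding split_sum_def by (rule sum_weighted_reflect(1)) (rule split_number_reflect)
  finally show ?thesis .
qed

section \<open>Generating functions\<close>

text \<open>The exponential generating function of (2n - 1)!!: without inner points no pair is
  mixed, so all perfect matchings of \<open>2 * n\<close> points are counted.\<close>

definition matching_series :: "real fps" where
  "matching_series = Abs_fps (\<lambda>n. real (split_number 0 (2 * n) 0) / fact n)"

text \<open>The differential equation makes the derivative of
  \<open>?d\<^sup>2 * (1 - 2 * fps_X)\<close> vanish, so this series equals its constant term 1.
  Hence \<open>?d * ?s\<close> squares to 1.\<close>

lemma matching_series_mult_sqrt: "matching_series * fps_radical root 2 (1 - 2 * fps_X) = 1"
proof -
  let ?d = matching_series and ?s = "fps_radical root 2 (1 - 2 * fps_X :: real fps)"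
  have d0: "?d $ 0 = 1"
    by (simp add: matching_series_def)
  have ode: "(1 - 2 * fps_X) * fps_deriv ?d = ?d"
  proof (rule fps_ext)
    fix n
    have double: "split_number 0 (2 * Suc m) 0 = (2 * m + 1) * split_number 0 (2 * m) 0" for m
      by simp
    have rec: "real (Suc m) * ?d $ Suc m = (2 * real m + 1) * ?d $ m" for m
    proof -
      have "fact (Suc m) = real (Suc m) * fact m"
        by (rule fact_Suc)
      then have "real (Suc m) * ?d $ Suc m = real (split_number 0 (2 * Suc m) 0) / fact m"
        by (simp add: matching_series_def del: split_number.simps fact_Suc)
      then show ?thesis
        unfolding double by (simp add: matching_series_def distrib_right)
    qed
    have "((1 - 2 * fps_X) * fps_deriv ?d) $ n = real (Suc n) * ?d $ Suc n - 2 * (real n * ?d $ n)"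
      by (cases n) (simp_all add: left_diff_distrib mult.assoc numeral_fps_const)
    with rec show "((1 - 2 * fps_X) * fps_deriv ?d) $ n = ?d $ n"
      by (simp add: algebra_simps)
  qed
  have "fps_deriv (?d\<^sup>2 * (1 - 2 * fps_X)) = 2 * ?d * ((1 - 2 * fps_X) * fps_deriv ?d) - 2 * ?d\<^sup>2"
    by (simp add: power2_eq_square algebra_simps)
  also have "\<dots> = 0"
    by (simp add: ode power2_eq_square)
  finally have "?d\<^sup>2 * (1 - 2 * fps_X) = fps_const ((?d\<^sup>2 * (1 - 2 * fps_X)) $ 0)"
    by (simp only: fps_deriv_eq_0_iff)
  then have "?d\<^sup>2 * (1 - 2 * fps_X) = 1"
    by (simp add: d0 power2_eq_square)
  moreover have "?s\<^sup>2 = 1 - 2 * fps_X"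
    using power_radical[of "1 - 2 * fps_X :: real fps" root 1] by (simp add: numeral_2_eq_2)
  ultimately have "(?d * ?s)\<^sup>2 = 1"
    by (simp add: power_mult_distrib)
  \<comment> \<open>The constant term rules out the other square root -1.\<close>
  moreover have "(?d * ?s) $ 0 \<noteq> (-1) $ 0"
    by (simp add: d0)
  ultimately show ?thesis
    by (metis power2_eq_1_iff)
qed

lemma split_number_0_left: "p > 0 \<Longrightarrow> split_number 0 k p = 0"
  by (simp add: split_number_eq_0)

text \<open>The factor \<open>n + 1\<close> in \<open>K_count_Suc\<close> cancels against the
  factorial, leaving \<open>var_z * L\<close>; \<open>split_sum_Suc\<close> then becomes a linear
  equation for \<open>L\<close>.\<close>

lemma K_series_mult: "K_series * (1 - var_z * (1 + var_y)) = var_z * lift_z matching_series"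
proof -
  define L :: "real fps fps" where "L = Abs_fps (\<lambda>n. Abs_fps (\<lambda>p. real (split_sum n p) / fact n))"
  have "K_series = var_z * L"
  proof (rule fps_ext, rule fps_ext)
    fix n p
    show "K_series $ n $ p = (var_z * L) $ n $ p"
    proof (cases n)
      case (Suc m)
      have "K_series $ n $ p = (if p \<le> m then real (K_count n p) / fact n else 0)"
        by (simp add: K_series_def Suc fps_sum_nth if_distrib cong: if_cong)
      \<comment> \<open>The inner sum of \<open>K_series\<close> stops at \<open>p = m\<close>,
        beyond which \<open>split_sum m p\<close> is 0.\<close>
      also have "\<dots> = real (split_sum m p) / fact m"
      proof -
        have "real (K_count (Suc m) p) = real (Suc m) * real (split_sum m p)"
          unfolding K_count_Suc of_nat_mult by simp
        then have "real (K_count (Suc m) p) / fact (Suc m) = real (split_sum m p) / fact m"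
          by (simp del: of_nat_Suc)
        then show ?thesis
          by (simp add: Suc split_sum_eq_0 del: fact_Suc)
      qed
      finally show ?thesis
        by (simp add: Suc L_def)
    qed (simp add: K_series_def)
  qed
  moreover have "L * (1 - var_z * (1 + var_y)) = lift_z matching_series"
  proof (rule fps_ext, rule fps_ext)
    fix n p
    have eq: "L * (1 - var_z * (1 + var_y)) = L - var_z * (L + var_y * L)"
      by (simp add: algebra_simps)
    show "(L * (1 - var_z * (1 + var_y))) $ n $ p = lift_z matching_series $ n $ p"
    proof (cases n)
      case 0
      then show ?thesis
        unfolding eq by (simp add: L_def lift_z_def matching_series_def split_sum_def)
    next
      case (Suc m)
      have "(L * (1 - var_z * (1 + var_y))) $ n $ p =
          L $ Suc m $ p - (L $ m $ p + (if p = 0 then 0 else L $ m $ (p - 1)))"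
        unfolding eq by (simp add: Suc)
      also have "\<dots> = real (split_number 0 (2 * Suc m) p) / fact (Suc m)"
      proof -
        define S where "S = split_sum m p + (if p = 0 then 0 else split_sum m (p - 1))"
        have "real (split_sum (Suc m) p) = real (split_number 0 (2 * Suc m) p) + real (Suc m) * real S"
          unfolding split_sum_Suc S_def[symmetric] of_nat_add of_nat_mult by simp
        moreover have "L $ m $ p + (if p = 0 then 0 else L $ m $ (p - 1)) = real S / fact m"
          by (simp add: L_def S_def add_divide_distrib)
        moreover have "real (Suc m) * real S / fact (Suc m) = real S / fact m"
          by (simp del: of_nat_Suc)
        ultimately show ?thesis
          by (simp add: L_def add_divide_distrib del: split_number.simps of_nat_Suc fact_Suc)
      qed
      \<comment> \<open>For \<open>p > 0\<close> both sides are 0, since \<open>lift_z\<close>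
        yields coefficients constant in y.\<close>
      finally show ?thesis
        by (simp add: Suc lift_z_def matching_series_def split_number_0_left del: split_number.simps)
    qed
  qed
  ultimately show ?thesis
    by (metis mult.assoc)
qed

theorem theorem8:
  shows "K_series = var_z / (sqrt_1_minus_2z * (1 - var_z * (1 + var_y)))"
proof -
  let ?g = "sqrt_1_minus_2z * (1 - var_z * (1 + var_y))"
  have g0: "?g $ 0 = 1"
    by (simp add: sqrt_1_minus_2z_nth_0)
  have "lift_z 1 = 1"
    by (rule fps_ext) (simp add: lift_z_def)
  then have "lift_z matching_series * sqrt_1_minus_2z = 1"
    by (simp add: sqrt_1_minus_2z_def matching_series_mult_sqrt flip: lift_z_mult)
  moreover have "K_series * ?g = K_series * (1 - var_z * (1 + var_y)) * sqrt_1_minus_2z"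
    by (simp only: mult_ac)
  ultimately have "K_series * ?g = var_z"
    by (simp add: K_series_mult mult.assoc)
  also have "\<dots> = var_z / ?g * ?g"
    by (simp only: divide_mult_cancel_unit[OF g0])
  finally have "K_series * ?g = var_z / ?g * ?g" .
  \<comment> \<open>Series over series over the reals form an integral domain, so the nonzero factor
    \<open>?g\<close> cancels.\<close>
  moreover have "?g \<noteq> 0"
    using g0 by force
  ultimately show ?thesis
    by (simp only: mult_cancel_right) simp
qed

end
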